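(* Let $\Bbbk$ be an algebraically closed field of characteristic zero and $\Lambda_2(\Bbbk)=\Bbbk\langle x,y:yx=xy+y^2\rangle$ the Jordanian plane. Let $w\in\Lambda_2(\Bbbk)$, let $\delta=\mathrm{ad}_w$ be the inner derivation $\delta(a)=wa-aw$ of $\Lambda_2(\Bbbk)$, and let $\rho\in\mathrm{Aut}(\Lambda_2(\Bbbk))$. Then $\rho\in\mathrm{Aut}_\delta(\Lambda_2(\Bbbk))$ if and only if $\rho(w)-w\in\Bbbk$.
   Context: $\mathrm{Aut}(\Lambda_2(\Bbbk))$ is the group of $\Bbbk$-algebra automorphisms. For a derivation $\delta$, the isotropy group is $\mathrm{Aut}_\delta(\Lambda_2(\Bbbk))=\{\rho\in\mathrm{Aut}(\Lambda_2(\Bbbk)):\rho\delta=\delta\rho\}$. Known fact: every automorphism of $\Lambda_2(\Bbbk)$ has the form $x\mapsto\gamma x+g(y)$, $y\mapsto\gamma y$ with $\gamma\in\Bbbk^*$, $g(y)\in\Bbbk[y]$. *)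

theory Defs
  imports "HOL-Library.Poly_Mapping" "HOL-Computational_Algebra.Computational_Algebra"
begin

section \<open>The free algebra on two generators\<close>

datatype gen = GX | GY

text \<open>Words form a monoid under concatenation, written additively because the convolution
  product of \<^type>\<open>poly_mapping\<close> takes the monoid of exponents additively.\<close>

datatype word = Word (letters: "gen list")

instantiation word :: monoid_add
begin

definition zero_word :: word where "0 = Word []"

definition plus_word :: "word \<Rightarrow> word \<Rightarrow> word" where
  "u + v = Word (letters u @ letters v)"

instance
  by standard (simp_all add: zero_word_def plus_word_def)

end

type_synonym 'k free_algebra = "word \<Rightarrow>\<^sub>0 'k"

definition free_gen :: "gen \<Rightarrow> 'k::field free_algebra" where
  "free_gen g = Poly_Mapping.single (Word [g]) 1"

definition free_const :: "'k::field \<Rightarrow> 'k free_algebra" where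
  "free_const c = Poly_Mapping.single 0 c"

lemma word_add_eq_0_iff: "u + v = (0::word) \<longleftrightarrow> u = 0 \<and> v = 0"
  by (cases u; cases v) (simp add: zero_word_def plus_word_def)

lemma free_algebra_induct [case_names single sum]:
  fixes p :: "'k::field free_algebra"
  assumes single: "\<And>u c. P (Poly_Mapping.single u c)"
    and sum: "\<And>p q. P p \<Longrightarrow> P q \<Longrightarrow> P (p + q)"
  shows "P p"
proof (induction p rule: update_induct)
  case const
  show ?case using single[of 0 0] by simp
next
  case (update p u c)
  have "Poly_Mapping.update u c p = p + Poly_Mapping.single u c"
    using update.hyps
    by (intro poly_mapping_eqI)
      (auto simp: lookup_update lookup_add lookup_single when_def in_keys_iff)
  then show ?case using sum[OF update.IH single] by simp
qed

lemma free_const_0: "free_const 0 = 0"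
  and free_const_1: "free_const 1 = 1"
  and free_const_add: "free_const (c + d) = free_const c + free_const d"
  and free_const_mult: "free_const (c * d) = free_const c * free_const d"
  by (simp_all add: free_const_def single_add mult_single)

lemma free_const_commute: "free_const c * p = p * free_const (c::'k::field)"
proof (induction p rule: free_algebra_induct)
  case (single u d)
  show ?case by (simp add: free_const_def mult_single mult.commute)
next
  case (sum p q)
  then show ?case by (simp add: distrib_left distrib_right)
qed


section \<open>The Jordanian plane\<close>

inductive_set two_sided_ideal :: "'a::ring_1 set \<Rightarrow> 'a set" for S :: "'a set" where
  gen: "s \<in> S \<Longrightarrow> s \<in> two_sided_ideal S"
| zero: "0 \<in> two_sided_ideal S"
| add: "a \<in> two_sided_ideal S \<Longrightarrow> b \<in> two_sided_ideal S \<Longrightarrow> a + b \<in> two_sided_ideal S"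
| lmult: "a \<in> two_sided_ideal S \<Longrightarrow> r * a \<in> two_sided_ideal S"
| rmult: "a \<in> two_sided_ideal S \<Longrightarrow> a * r \<in> two_sided_ideal S"

lemma two_sided_ideal_uminus: "a \<in> two_sided_ideal S \<Longrightarrow> - a \<in> two_sided_ideal S"
  using two_sided_ideal.lmult[of a S "-1"] by simp

lemma two_sided_ideal_diff:
  "a \<in> two_sided_ideal S \<Longrightarrow> b \<in> two_sided_ideal S \<Longrightarrow> a - b \<in> two_sided_ideal S"
  using two_sided_ideal.add[of a S "- b"] two_sided_ideal_uminus[of b S] by simp

definition jordan_ideal :: "'k::field free_algebra set" where
  "jordan_ideal =
    two_sided_ideal {free_gen GY * free_gen GX - (free_gen GX * free_gen GY + free_gen GY ^ 2)}"

definition jordan_rel :: "'k::field free_algebra \<Rightarrow> 'k free_algebra \<Rightarrow> bool" where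
  "jordan_rel p q \<longleftrightarrow> p - q \<in> jordan_ideal"

lemma equivp_jordan_rel: "equivp jordan_rel"
proof (rule equivpI)
  show "reflp (jordan_rel :: 'a free_algebra \<Rightarrow> _)"
    by (simp add: reflp_def jordan_rel_def jordan_ideal_def two_sided_ideal.zero)
  show "symp (jordan_rel :: 'a free_algebra \<Rightarrow> _)"
  proof (rule sympI)
    fix p q :: "'a free_algebra"
    assume "jordan_rel p q"
    then have "- (p - q) \<in> jordan_ideal"
      unfolding jordan_rel_def jordan_ideal_def by (rule two_sided_ideal_uminus)
    then show "jordan_rel q p" by (simp add: jordan_rel_def)
  qed
  show "transp (jordan_rel :: 'a free_algebra \<Rightarrow> _)"
  proof (rule transpI)
    fix p q r :: "'a free_algebra"
    assume "jordan_rel p q" "jordan_rel q r"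
    then have "(p - q) + (q - r) \<in> jordan_ideal"
      unfolding jordan_rel_def jordan_ideal_def by (rule two_sided_ideal.add)
    then show "jordan_rel p r" by (simp add: jordan_rel_def)
  qed
qed

quotient_type (overloaded) 'k jordan_plane = "'k::field free_algebra" / jordan_rel
  by (rule equivp_jordan_rel)

lemma lookup_mult_0:
  "Poly_Mapping.lookup (p * q) 0 =
    Poly_Mapping.lookup p 0 * Poly_Mapping.lookup (q :: 'k::field free_algebra) 0"
proof (induction p rule: free_algebra_induct)
  case (single u c)
  show ?case
  proof (induction q rule: free_algebra_induct)
    case (single v d)
    show ?case by (auto simp: mult_single lookup_single when_def word_add_eq_0_iff)
  next
    case (sum q1 q2)
    then show ?case by (simp add: distrib_left lookup_add)
  qed
next
  case (sum p1 p2)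
  then show ?case by (simp add: distrib_right lookup_add)
qed

lemma jordan_ideal_lookup_0:
  "p \<in> jordan_ideal \<Longrightarrow> Poly_Mapping.lookup (p :: 'k::field free_algebra) 0 = 0"
  unfolding jordan_ideal_def
proof (induction rule: two_sided_ideal.induct)
  case (gen s)
  have "Poly_Mapping.lookup (free_gen g :: 'k free_algebra) 0 = 0" for g
    by (simp add: free_gen_def lookup_single when_def zero_word_def)
  with gen show ?case
    by (simp add: lookup_minus lookup_add lookup_mult_0 power2_eq_square)
qed (simp_all add: lookup_add lookup_mult_0)

lemma one_notin_jordan_ideal: "1 \<notin> (jordan_ideal :: 'k::field free_algebra set)"
  using jordan_ideal_lookup_0[of "1 :: 'k free_algebra"] by auto

instantiation jordan_plane :: (field) ring_1
begin

lift_definition zero_jordan_plane :: "'a jordan_plane" is 0 .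

lift_definition one_jordan_plane :: "'a jordan_plane" is 1 .

lift_definition plus_jordan_plane :: "'a jordan_plane \<Rightarrow> 'a jordan_plane \<Rightarrow> 'a jordan_plane"
  is "(+)"
proof -
  fix p p' q q' :: "'a free_algebra"
  assume "jordan_rel p p'" "jordan_rel q q'"
  then have "(p - p') + (q - q') \<in> jordan_ideal"
    unfolding jordan_rel_def jordan_ideal_def by (rule two_sided_ideal.add)
  then show "jordan_rel (p + q) (p' + q')" by (simp add: jordan_rel_def algebra_simps)
qed

lift_definition uminus_jordan_plane :: "'a jordan_plane \<Rightarrow> 'a jordan_plane"
  is uminus
proof -
  fix p p' :: "'a free_algebra"
  assume "jordan_rel p p'"
  then have "- (p - p') \<in> jordan_ideal"
    unfolding jordan_rel_def jordan_ideal_def by (rule two_sided_ideal_uminus)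
  then show "jordan_rel (- p) (- p')" by (simp add: jordan_rel_def)
qed

lift_definition minus_jordan_plane :: "'a jordan_plane \<Rightarrow> 'a jordan_plane \<Rightarrow> 'a jordan_plane"
  is "(-)"
proof -
  fix p p' q q' :: "'a free_algebra"
  assume "jordan_rel p p'" "jordan_rel q q'"
  then have "(p - p') - (q - q') \<in> jordan_ideal"
    unfolding jordan_rel_def jordan_ideal_def by (rule two_sided_ideal_diff)
  then show "jordan_rel (p - q) (p' - q')" by (simp add: jordan_rel_def algebra_simps)
qed

lift_definition times_jordan_plane :: "'a jordan_plane \<Rightarrow> 'a jordan_plane \<Rightarrow> 'a jordan_plane"
  is "(*)"
proof -
  fix p p' q q' :: "'a free_algebra"
  assume "jordan_rel p p'" "jordan_rel q q'"
  then have "(p - p') * q + p' * (q - q') \<in> jordan_ideal"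
    unfolding jordan_rel_def jordan_ideal_def
    by (intro two_sided_ideal.add two_sided_ideal.lmult two_sided_ideal.rmult)
  then show "jordan_rel (p * q) (p' * q')" by (simp add: jordan_rel_def algebra_simps)
qed

instance
proof
  show "(0::'a jordan_plane) \<noteq> 1"
  proof (transfer, rule notI)
    assume "jordan_rel (0 :: 'a free_algebra) 1"
    then have "- (0 - 1 :: 'a free_algebra) \<in> jordan_ideal"
      unfolding jordan_rel_def jordan_ideal_def by (rule two_sided_ideal_uminus)
    then show False using one_notin_jordan_ideal[where 'k = 'a] by simp
  qed
qed (transfer, simp add: algebra_simps equivp_reflp[OF equivp_jordan_rel])+

end

lift_definition jordan_x :: "'k::field jordan_plane" is "free_gen GX" .

lift_definition jordan_y :: "'k::field jordan_plane" is "free_gen GY" .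

lift_definition jordan_const :: "'k::field \<Rightarrow> 'k jordan_plane" is free_const .

lemma jordan_relation:
  "jordan_y * jordan_x = jordan_x * jordan_y + (jordan_y :: 'k::field jordan_plane) ^ 2"
  unfolding power2_eq_square
  by transfer (simp add: jordan_rel_def jordan_ideal_def two_sided_ideal.gen power2_eq_square)

definition jordan_scale :: "'k::field \<Rightarrow> 'k jordan_plane \<Rightarrow> 'k jordan_plane" where
  "jordan_scale c a = jordan_const c * a"

lemma jordan_const_0: "jordan_const 0 = 0"
  and jordan_const_1: "jordan_const 1 = 1"
  and jordan_const_add: "jordan_const (c + d) = jordan_const c + jordan_const d"
  and jordan_const_mult: "jordan_const (c * d) = jordan_const c * jordan_const d"
  by (transfer; simp add: free_const_0 free_const_1 free_const_add free_const_mult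
      equivp_reflp[OF equivp_jordan_rel])+

lemma jordan_const_commute: "jordan_const c * a = a * jordan_const c"
  by transfer (metis free_const_commute equivp_reflp[OF equivp_jordan_rel])

lemma vector_space_jordan_scale: "vector_space (jordan_scale :: 'k::field \<Rightarrow> _)"
  by standard
    (simp_all add: jordan_scale_def jordan_const_1 jordan_const_add jordan_const_mult
      distrib_left distrib_right mult.assoc)


section \<open>Automorphisms, derivations and isotropy\<close>

definition jordan_aut :: "('k::field jordan_plane \<Rightarrow> 'k jordan_plane) set" where
  "jordan_aut = {\<rho>. Vector_Spaces.linear jordan_scale jordan_scale \<rho> \<and>
     \<rho> 1 = 1 \<and> (\<forall>a b. \<rho> (a * b) = \<rho> a * \<rho> b) \<and> bij \<rho>}"

definition jordan_derivation :: "('k::field jordan_plane \<Rightarrow> 'k jordan_plane) \<Rightarrow> bool" where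
  "jordan_derivation \<delta> \<longleftrightarrow> Vector_Spaces.linear jordan_scale jordan_scale \<delta> \<and>
     (\<forall>a b. \<delta> (a * b) = \<delta> a * b + a * \<delta> b)"

definition ad :: "'a::ring \<Rightarrow> 'a \<Rightarrow> 'a" where
  "ad w a = w * a - a * w"

lemma jordan_derivation_ad: "jordan_derivation (ad (w :: 'k::field jordan_plane))"
proof -
  have "w * (jordan_const c * b) = jordan_const c * (w * b)" for c b
    by (metis jordan_const_commute mult.assoc)
  then have "Vector_Spaces.linear jordan_scale jordan_scale (ad w)"
    using vector_space_jordan_scale
    by (simp add: Vector_Spaces.linear_iff ad_def jordan_scale_def algebra_simps)
  then show ?thesis
    by (simp add: jordan_derivation_def ad_def algebra_simps)
qed

definition jordan_isotropy ::
    "('k::field jordan_plane \<Rightarrow> 'k jordan_plane) \<Rightarrow> ('k jordan_plane \<Rightarrow> 'k jordan_plane) set" where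
  "jordan_isotropy \<delta> = {\<rho> \<in> jordan_aut. \<rho> \<circ> \<delta> = \<delta> \<circ> \<rho>}"

end

theory Submission
  imports Defs
begin

text \<open>Since \<open>\<rho>\<close> is an automorphism, it commutes with \<open>ad w\<close> iff \<open>\<rho> w - w\<close> is central, so everything
  rests on the centre of the Jordanian plane being \<open>\<bbbk>\<close>. The plane acts on \<open>\<bbbk>[t][y]\<close>, with \<open>y\<close> acting
  by multiplication and \<open>x\<close> as \<open>t - y\<^sup>2 d/dy\<close>; this action is \<open>\<bbbk>[t]\<close>-linear, and \<open>a\<close> is recovered from
  \<open>a \<cdot> 1\<close> by putting powers of \<open>y\<close> to the left of powers of \<open>x\<close>. If \<open>z\<close> is central and \<open>f = z \<cdot> 1\<close>, then
  \<open>t f = z \<cdot> t = z x \<cdot> 1 = x z \<cdot> 1 = t f - y\<^sup>2 df/dy\<close>, so \<open>f = q(t)\<close> and \<open>z = q(x)\<close>. The coefficient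
  of \<open>y\<^sup>2\<close> in \<open>z \<cdot> y = y z \<cdot> 1 = q(t) y\<close> is \<open>- q'(t)\<close>, so \<open>q\<close> is constant.\<close>

section \<open>The action on polynomials\<close>

text \<open>In \<open>'k poly poly\<close> the outer variable is y and the inner one is t:
  \<open>[:[:0, 1:]:]\<close> is t, \<open>[:0, 1:]\<close> is y and \<open>pderiv\<close> is
  d/dy.\<close>

fun gen_act :: "gen \<Rightarrow> 'k::field poly poly \<Rightarrow> 'k poly poly" where
  "gen_act GX f = [:[:0, 1:]:] * f - [:0, 0, 1:] * pderiv f"
| "gen_act GY f = [:0, 1:] * f"

lemma gen_act_add: "gen_act g (f + h) = gen_act g f + gen_act g h"
  by (cases g) (simp_all only: gen_act.simps pderiv_add distrib_left add_diff_add)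

lemma gen_act_const: "gen_act g ([:p:] * f) = [:p:] * gen_act g f"
  by (cases g) (simp_all add: pderiv_smult smult_diff_right)

text \<open>The product rule d/dy (y f) = y df/dy + f leaves exactly y^2 f as the commutator of the
  two operators.\<close>

lemma gen_act_GY_GX:
  "gen_act GY (gen_act GX f) = gen_act GX (gen_act GY f) + gen_act GY (gen_act GY f)"
proof -
  have y2: "[:0, 0, 1:] = [:0, 1:] * ([:0, 1:] :: 'a poly poly)"
    by simp
  have "pderiv ([:0, 1:] * f) = [:0, 1:] * pderiv f + f"
    by (simp only: pderiv_mult) (simp add: pderiv_pCons)
  then show ?thesis
    by (simp only: gen_act.simps y2 algebra_simps)
qed

definition word_act :: "word \<Rightarrow> 'k::field poly poly \<Rightarrow> 'k poly poly" where
  "word_act u f = foldr gen_act (letters u) f"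

lemma word_act_0: "word_act 0 f = f"
  by (simp add: word_act_def zero_word_def)

lemma word_act_plus: "word_act (u + v) f = word_act u (word_act v f)"
  by (simp add: word_act_def plus_word_def)

lemma word_act_add: "word_act u (f + h) = word_act u f + word_act u h"
proof -
  have "foldr gen_act gs (f + h) = foldr gen_act gs f + foldr gen_act gs h" for gs
    by (induction gs) (simp_all add: gen_act_add)
  then show ?thesis by (simp add: word_act_def)
qed

lemma word_act_const: "word_act u ([:p:] * f) = [:p:] * word_act u f"
proof -
  have "foldr gen_act gs ([:p:] * f) = [:p:] * foldr gen_act gs f" for gs
    by (induction gs) (simp_all only: foldr.simps comp_apply id_apply gen_act_const)
  then show ?thesis by (simp add: word_act_def)
qed

definition free_act :: "'k::field free_algebra \<Rightarrow> 'k poly poly \<Rightarrow> 'k poly poly" where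
  "free_act p f = (\<Sum>u\<in>Poly_Mapping.keys p. [:[:Poly_Mapping.lookup p u:]:] * word_act u f)"

lemma free_act_single: "free_act (Poly_Mapping.single u c) f = [:[:c:]:] * word_act u f"
  by (simp add: free_act_def)

lemma free_act_plus: "free_act (p + q) f = free_act p f + free_act q f"
  unfolding free_act_def
\<comment> \<open>Keys may cancel in \<open>p + q\<close>; it suffices that the summand is additive
  in the coefficient and vanishes at coefficient 0.\<close>
proof (rule setsum_keys_plus_distrib)
  fix u and c d :: 'a
  have "[:[:c + d:]:] = [:[:c:]:] + [:[:d:]:]" by simp
  then show "[:[:c + d:]:] * word_act u f = [:[:c:]:] * word_act u f + [:[:d:]:] * word_act u f"
    by (simp only: distrib_right)
qed simp

lemma free_act_add: "free_act p (f + h) = free_act p f + free_act p h"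
  by (simp add: free_act_def word_act_add sum.distrib smult_add_right)

lemma free_act_const: "free_act p ([:r:] * f) = [:r:] * free_act p f"
  unfolding free_act_def by (simp only: word_act_const sum_distrib_left mult.left_commute)

lemma free_act_zero_right: "free_act p 0 = 0"
  using free_act_const[of p 0 0] by simp

lemma free_act_uminus: "free_act (- p) f = - free_act p f"
proof -
  have "free_act (- p) f + free_act p f = 0"
    unfolding free_act_plus[symmetric] by (simp add: free_act_def)
  then show ?thesis by (simp add: eq_neg_iff_add_eq_0)
qed

lemma free_act_diff: "free_act (p - q) f = free_act p f - free_act q f"
  using free_act_plus[of p "- q" f] by (simp add: free_act_uminus)

lemma free_act_times: "free_act (p * q) f = free_act p (free_act q f)"
proof (induction p rule: free_algebra_induct)
  case (single u c)
  show ?case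
  proof (induction q rule: free_algebra_induct)
    case (single v d)
    have "[:[:c * d:]:] = [:[:c:]:] * [:[:d:]:]" by simp
    then show ?case
      by (simp only: mult_single free_act_single word_act_plus word_act_const mult.assoc)
  next
    case (sum q r)
    then show ?case by (simp only: distrib_left free_act_plus free_act_add)
  qed
next
  case (sum p r)
  then show ?case by (simp only: distrib_right free_act_plus)
qed

lemma free_act_gen: "free_act (free_gen g) f = gen_act g f"
proof -
  have "[:[:1:]:] = (1 :: 'a poly poly)" by (simp add: one_pCons)
  then show ?thesis
    by (simp only: free_gen_def free_act_single mult_1_left) (simp add: word_act_def)
qed

text \<open>The relator acts as zero and annihilators of modules are two-sided ideals, so the action
  descends to the plane.\<close>

lemma free_act_jordan_ideal: "p \<in> jordan_ideal \<Longrightarrow> free_act p f = 0"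
  unfolding jordan_ideal_def
\<comment> \<open>\<open>f\<close> varies because \<open>a * r\<close> acts on \<open>f\<close> as
  \<open>a\<close> acts on the image of \<open>f\<close> under \<open>r\<close>.\<close>
proof (induction arbitrary: f rule: two_sided_ideal.induct)
  case (gen s)
  then have s: "s = free_gen GY * free_gen GX - (free_gen GX * free_gen GY + free_gen GY ^ 2)"
    by simp
  show ?case
    unfolding s power2_eq_square free_act_diff free_act_plus free_act_times free_act_gen
    by (simp only: gen_act_GY_GX diff_self)
qed (simp_all add: free_act_plus free_act_times free_act_zero_right, simp add: free_act_def)

lift_definition jordan_act :: "'k::field jordan_plane \<Rightarrow> 'k poly poly \<Rightarrow> 'k poly poly"
  is free_act
proof (rule ext)
  fix p q :: "'k::field free_algebra" and f
  assume "jordan_rel p q"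
  then have "free_act (p - q) f = 0"
    unfolding jordan_rel_def by (rule free_act_jordan_ideal)
  then show "free_act p f = free_act q f" by (simp add: free_act_diff)
qed

lemma jordan_act_plus: "jordan_act (a + b) f = jordan_act a f + jordan_act b f"
  by transfer (rule free_act_plus)

lemma jordan_act_times: "jordan_act (a * b) f = jordan_act a (jordan_act b f)"
  by transfer (rule free_act_times)

lemma jordan_act_linear: "jordan_act a ([:r:] * f) = [:r:] * jordan_act a f"
  by transfer (rule free_act_const)

lemma jordan_act_x: "jordan_act jordan_x f = [:[:0, 1:]:] * f - [:0, 0, 1:] * pderiv f"
  by transfer (simp only: free_act_gen gen_act.simps)

lemma jordan_act_y: "jordan_act jordan_y f = [:0, 1:] * f"
  by transfer (simp only: free_act_gen gen_act.simps)

lemma jordan_act_const: "jordan_act (jordan_const c) f = [:[:c:]:] * f"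
  by transfer (simp only: free_const_def free_act_single word_act_0)

section \<open>Normal forms\<close>

lemma jordan_plane_induct [case_names const x y sum]:
  fixes a :: "'k::field jordan_plane"
  assumes const: "\<And>c. P (jordan_const c)"
    and x: "\<And>a. P a \<Longrightarrow> P (jordan_x * a)"
    and y: "\<And>a. P a \<Longrightarrow> P (jordan_y * a)"
    and sum: "\<And>a b. P a \<Longrightarrow> P b \<Longrightarrow> P (a + b)"
  shows "P a"
proof (induction a rule: jordan_plane.abs_induct)
  case (1 p)
  show ?case
  proof (induction p rule: free_algebra_induct)
    case (single u c)
    have "P (abs_jordan_plane (Poly_Mapping.single (Word gs) c))" for gs
    proof (induction gs)
      case Nil
      show ?case
        using const[of c]
        by (simp add: jordan_const.abs_eq free_const_def zero_word_def)
    next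
      case (Cons g gs)
      have "Poly_Mapping.single (Word (g # gs)) c
          = free_gen g * Poly_Mapping.single (Word gs) c"
        by (simp add: free_gen_def mult_single plus_word_def)
      then have "abs_jordan_plane (Poly_Mapping.single (Word (g # gs)) c)
          = abs_jordan_plane (free_gen g) * abs_jordan_plane (Poly_Mapping.single (Word gs) c)"
        by (simp add: times_jordan_plane.abs_eq)
      then show ?case
        using x[OF Cons.IH] y[OF Cons.IH]
        by (cases g) (simp_all add: jordan_x_def jordan_y_def)
    qed
    then show ?case by (metis word.exhaust)
  next
    case (sum p q)
    then show ?case by (metis assms(4) plus_jordan_plane.abs_eq)
  qed
qed

text \<open>The evaluation q(x), written as a Horner scheme.\<close>

definition x_poly :: "'k::field poly \<Rightarrow> 'k jordan_plane" where
  "x_poly q = fold_coeffs (\<lambda>c a. jordan_const c + jordan_x * a) q 0"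

lemma x_poly_0: "x_poly 0 = 0"
  by (simp add: x_poly_def)

lemma x_poly_pCons: "x_poly (pCons c q) = jordan_const c + jordan_x * x_poly q"
  by (cases "c = 0"; cases "q = 0") (simp_all add: x_poly_def jordan_const_0)

lemma x_poly_const: "x_poly [:c:] = jordan_const c"
  by (simp add: x_poly_pCons x_poly_0)

lemma x_poly_add: "x_poly (p + q) = x_poly p + x_poly q"
  by (induction p q rule: poly_induct2)
    (simp_all add: x_poly_0 x_poly_pCons jordan_const_add distrib_left)

lemma x_poly_const_mult: "x_poly ([:c:] * q) = jordan_const c * x_poly q"
proof (induction q rule: pCons_induct)
  case 0
  show ?case by (simp add: x_poly_0)
next
  case (pCons d q)
  have "jordan_const c * (jordan_x * x_poly q) = jordan_x * (jordan_const c * x_poly q)"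
    by (metis jordan_const_commute mult.assoc)
  with pCons.IH show ?case
    by (simp add: x_poly_pCons jordan_const_mult distrib_left jordan_const_commute[of c "jordan_const d"])
qed

text \<open>The sum of y^i q_i(t) goes to the sum of y^i q_i(x), with y on the left.\<close>

definition yx_poly :: "'k::field poly poly \<Rightarrow> 'k jordan_plane" where
  "yx_poly f = fold_coeffs (\<lambda>q a. x_poly q + jordan_y * a) f 0"

lemma yx_poly_0: "yx_poly 0 = 0"
  by (simp add: yx_poly_def)

lemma yx_poly_pCons: "yx_poly (pCons q f) = x_poly q + jordan_y * yx_poly f"
  by (cases "q = 0"; cases "f = 0") (simp_all add: yx_poly_def x_poly_0)

lemma yx_poly_const: "yx_poly [:q:] = x_poly q"
  by (simp add: yx_poly_pCons yx_poly_0)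

lemma yx_poly_add: "yx_poly (f + h) = yx_poly f + yx_poly h"
  by (induction f h rule: poly_induct2)
    (simp_all add: yx_poly_0 yx_poly_pCons x_poly_add distrib_left)

lemma yx_poly_diff: "yx_poly (f - h) = yx_poly f - yx_poly h"
  using yx_poly_add[of "f - h" h] by (simp add: eq_diff_eq)

lemma yx_poly_const_mult: "yx_poly ([:[:c:]:] * f) = jordan_const c * yx_poly f"
proof (induction f rule: pCons_induct)
  case 0
  show ?case by (simp add: yx_poly_0)
next
  case (pCons q f)
  have "jordan_const c * (jordan_y * yx_poly f) = jordan_y * (jordan_const c * yx_poly f)"
    by (metis jordan_const_commute mult.assoc)
  with pCons.IH x_poly_const_mult[of c q] show ?case
    by (simp add: yx_poly_pCons distrib_left)
qed

text \<open>Moving x to the right past a power of y by x y = y x - y^2 produces the term - y^2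
  d/dy.\<close>

lemma yx_poly_x:
  "yx_poly ([:[:0, 1:]:] * f - [:0, 0, 1:] * pderiv f) = jordan_x * yx_poly f"
proof (induction f rule: pCons_induct)
  case 0
  show ?case by (simp add: yx_poly_0)
next
  case (pCons q f)
  define X :: "'a poly poly \<Rightarrow> 'a poly poly"
    where "X f = [:[:0, 1:]:] * f - [:0, 0, 1:] * pderiv f" for f
  have IH: "yx_poly (X f) = jordan_x * yx_poly f"
    unfolding X_def by (rule pCons.IH)
  \<comment> \<open>With \<open>pCons q f\<close> read as q + y f, the product rule gives t q + y
    X(f) - y^2 f.\<close>
  have "X (pCons q f) = pCons (pCons 0 q) (X f) - pCons 0 (pCons 0 f)"
    by (simp add: X_def pderiv_pCons algebra_simps)
  then have "yx_poly (X (pCons q f))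
      = jordan_x * x_poly q + (jordan_y * jordan_x - jordan_y * jordan_y) * yx_poly f"
    by (simp add: yx_poly_diff yx_poly_pCons IH x_poly_pCons x_poly_0 jordan_const_0 algebra_simps)
  also have "\<dots> = jordan_x * yx_poly (pCons q f)"
    unfolding jordan_relation power2_eq_square yx_poly_pCons by (simp add: algebra_simps)
  finally show ?case unfolding X_def .
qed

text \<open>\<open>yx_poly\<close> is a homomorphism of left modules into the plane itself;
  constants and generators suffice to check this.\<close>

lemma yx_poly_jordan_act: "yx_poly (jordan_act a f) = a * yx_poly f"
proof (induction a arbitrary: f rule: jordan_plane_induct)
  case (const c)
  show ?case by (simp only: jordan_act_const yx_poly_const_mult)
next
  case (x a)
  then show ?case by (simp only: jordan_act_times jordan_act_x yx_poly_x mult.assoc)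
next
  case (y a)
  then show ?case
    by (simp add: jordan_act_times jordan_act_y yx_poly_pCons x_poly_0 mult.assoc)
next
  case (sum a b)
  then show ?case by (simp only: jordan_act_plus yx_poly_add distrib_right)
qed

lemma yx_poly_jordan_act_1: "yx_poly (jordan_act a 1) = a"
proof -
  have "yx_poly 1 = (1 :: 'a jordan_plane)"
    by (simp add: one_pCons yx_poly_const x_poly_const jordan_const_1)
  then show ?thesis by (simp add: yx_poly_jordan_act)
qed

section \<open>The centre\<close>

text \<open>Applying x to g_0 + g_1 y + g_2 y^2 + ... multiplies g_0 and g_1 by t and turns g_2 into
  t g_2 - g_1; the last recursion is the product rule for - (t q)'.\<close>

lemma coeff_jordan_act_x_poly:
  "coeff (jordan_act (x_poly q) [:0, 1:]) 0 = 0 \<and>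
   coeff (jordan_act (x_poly q) [:0, 1:]) 1 = q \<and>
   coeff (jordan_act (x_poly q) [:0, 1:]) 2 = - pderiv q"
proof (induction q rule: pCons_induct)
  case 0
  have "jordan_act 0 f = 0" for f :: "'a poly poly"
    using jordan_act_const[of 0 f] by (simp add: jordan_const_0)
  then show ?case by (simp add: x_poly_0)
next
  case (pCons c q)
  then show ?case
    by (simp add: x_poly_pCons jordan_act_plus jordan_act_times jordan_act_const jordan_act_x
        coeff_pderiv numeral_2_eq_2 pderiv_pCons)
qed

theorem jordan_centre:
  fixes z :: "'k::field_char_0 jordan_plane"
  assumes central: "\<And>a. z * a = a * z"
  shows "z \<in> range jordan_const"
proof -
  define f where "f = jordan_act z 1"
  have "jordan_act z (jordan_act jordan_x 1) = jordan_act jordan_x f"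
    by (simp only: f_def central flip: jordan_act_times)
  \<comment> \<open>Here x sends 1 to t, which is a scalar for the action.\<close>
  moreover have "jordan_act z (jordan_act jordan_x 1) = [:[:0, 1:]:] * f"
    unfolding jordan_act_x f_def
    by (simp only: pderiv_1 mult_zero_right diff_0_right jordan_act_linear)
  ultimately have "[:0, 0, 1:] * pderiv f = 0"
    by (simp add: jordan_act_x)
  then have "pderiv f = 0" by (simp only: mult_eq_0_iff) simp
  \<comment> \<open>Characteristic zero makes \<open>f\<close> constant in y.\<close>
  then obtain q where q: "f = [:q:]"
    by (metis degree_eq_zeroE pderiv_eq_0_iff)
  have z: "z = x_poly q"
    using yx_poly_jordan_act_1[of z] by (simp add: q yx_poly_const flip: f_def)
  have "jordan_act z (jordan_act jordan_y 1) = jordan_act jordan_y f"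
    by (simp only: f_def central flip: jordan_act_times)
  then have "jordan_act (x_poly q) [:0, 1:] = [:0, q:]"
    by (simp add: z q jordan_act_y)
  then have "pderiv q = 0"
    using coeff_jordan_act_x_poly[of q] by (simp add: numeral_2_eq_2)
  then obtain c where "q = [:c:]"
    by (metis degree_eq_zeroE pderiv_eq_0_iff)
  then show ?thesis by (simp add: z x_poly_const)
qed

section \<open>Automorphisms commuting with an inner derivation\<close>

theorem proposition18:
  fixes w :: "'k::{alg_closed_field, field_char_0} jordan_plane"
    and \<rho> :: "'k jordan_plane \<Rightarrow> 'k jordan_plane"
  assumes "\<rho> \<in> jordan_aut"
  shows "\<rho> \<in> jordan_isotropy (ad w) \<longleftrightarrow> \<rho> w - w \<in> range jordan_const"
proof -
  have lin: "Vector_Spaces.linear jordan_scale jordan_scale \<rho>"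
    and mult: "\<And>a b. \<rho> (a * b) = \<rho> a * \<rho> b" and "bij \<rho>"
    using assms by (auto simp: jordan_aut_def)
  have diff: "\<rho> (a - b) = \<rho> a - \<rho> b" for a b
    using lin by (metis Vector_Spaces.linear_iff add_diff_cancel diff_add_cancel)
  \<comment> \<open>Applying \<rho> to w a - a w replaces w by \<rho> w and a by \<rho> a; the
    condition compares this with the commutator of w and \<rho> a.\<close>
  have "\<rho> \<in> jordan_isotropy (ad w) \<longleftrightarrow> (\<forall>a. (\<rho> w - w) * \<rho> a = \<rho> a * (\<rho> w - w))"
    using assms by (auto simp: jordan_isotropy_def fun_eq_iff ad_def diff mult algebra_simps)
  \<comment> \<open>By surjectivity \<rho> a runs through the whole plane.\<close>
  also have "\<dots> \<longleftrightarrow> (\<forall>b. (\<rho> w - w) * b = b * (\<rho> w - w))"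
    using \<open>bij \<rho>\<close> by (metis bij_pointE)
  also have "\<dots> \<longleftrightarrow> \<rho> w - w \<in> range jordan_const"
    using jordan_centre[of "\<rho> w - w"] by (auto simp: jordan_const_commute)
  finally show ?thesis .
qed

end
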